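(* Suppose the $N$-player aggregative game with payoffs $J_i$ and local feasible sets $\Omega_i\subseteq\mathbb{R}^n$ ($i\in\mathcal I=\{1,\dots,N\}$) satisfies Assumption A (see context), let $\beta_1,\beta_2$ satisfy the step-size conditions in the context, let $\varsigma_i$ be a Lipschitz constant of $J_i$, and let $V_{\boldsymbol\Omega}$ be a Lyapunov function of the system $\dot{\boldsymbol z}=G_{\boldsymbol\Omega}(\boldsymbol z)$ satisfying the inequalities (L) of the context with positive constants $a_1,a_2,a_3,a_4$. Let $\mu\in(0,1)$ be a constant. Then there are constants $\nu_i>0$ ($i\in\mathcal I$), $\nu_i$ depending only on $\Omega_i$ and not on its approximation, such that for all inscribed polyhedrons $\mathcal D^i_{s_i}$ of $\Omega_i$ ($i\in\mathcal I$), with $h_i=H(\Omega_i,\mathcal D^i_{s_i})$, $\boldsymbol H=\mathrm{col}(h_1,\dots,h_N)$ and $$\delta(\boldsymbol H)=(1+c_3)\sqrt{\sum_{i=1}^N\Big(\frac{2}{\nu_i}\arccos(1-\nu_ih_i)+h_i\Big)^2},$$ the Nash equilibrium $\boldsymbol x^*(\boldsymbol{\mathcal D}_s)$ of the approximate game (each player $i$ solves $\min_{x_i\in\mathcal D^i_{s_i}}J_i(x_i,\boldsymbol x_{-i})$) is an $\epsilon$-Nash equilibrium of the original game (each player $i$ solves $\min_{x_i\in\Omega_i}J_i(x_i,\boldsymbol x_{-i})$) with $$\epsilon\le\frac{2a_4}{a_3}\sqrt{\frac{a_2}{a_1}}\,\frac{\varsigma_i}{\mu}\,\delta(\boldsymbol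 H),$$ in the sense that for every $i\in\mathcal I$ and every $x_i'\in\Omega_i$, $$J_i(\boldsymbol x^*(\boldsymbol{\mathcal D}_s))-J_i(x_i',\boldsymbol x_{-i}^*(\boldsymbol{\mathcal D}_s))\le\frac{2a_4}{a_3}\sqrt{\frac{a_2}{a_1}}\,\frac{\varsigma_i}{\mu}\,\delta(\boldsymbol H).$$
   Context: Notation: $\boldsymbol\Omega=\prod_i\Omega_i\subseteq\mathbb{R}^{nN}$, $\boldsymbol{\mathcal D}_s=\prod_i\mathcal D^i_{s_i}$; $\boldsymbol x=\mathrm{col}(x_1,\dots,x_N)$, $\boldsymbol x_{-i}$ is the profile of all players except $i$; $\Pi_K$ is Euclidean projection onto a closed convex set $K$; $H$ is the Hausdorff metric between compact sets; $\|\cdot\|$ is the Euclidean norm. Aggregative game: $q_i:\mathbb{R}^n\to\mathbb{R}^M$, $\mathcal Q(\boldsymbol x)=\frac1N\sum_i q_i(x_i)$, $J_i(x_i,\boldsymbol x_{-i})=f_i(x_i,\mathcal Q(\boldsymbol x))$ with $f_i:\mathbb{R}^{n+M}\to\mathbb{R}$; $\boldsymbol q(\boldsymbol x)=\mathrm{col}(q_1(x_1),\dots,q_N(x_N))$. Pseudo-gradient: $F(\boldsymbol x)=\mathrm{col}(\nabla_{x_1}J_1(\boldsymbol x),\dots,\nabla_{x_N}J_N(\boldsymbol x))$. For $\zeta_i\in\mathbb{R}^M$, $U_i(x_i,\zeta_i)=\big(\nabla_{x_i}f_i(x_i,\mathcal Q)+\frac1N(Dq_i(x_i))^{\mathrm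 T}\nabla_{\mathcal Q}f_i(x_i,\mathcal Q)\big)|_{\mathcal Q=\zeta_i}\in\mathbb{R}^n$, where $Dq_i$ is the $M\times n$ Jacobian, and $U(\boldsymbol x,\boldsymbol\zeta)=\mathrm{col}(U_1(x_1,\zeta_1),\dots,U_N(x_N,\zeta_N))$. A Nash equilibrium of a game with feasible sets $K_i$ is $\boldsymbol x^*\in\prod_iK_i$ with $J_i(x_i^*,\boldsymbol x_{-i}^* )\le J_i(x_i,\boldsymbol x_{-i}^* )$ for all $i$, $x_i\in K_i$; it is an $\epsilon$-Nash equilibrium if the inequality holds with $+\epsilon$ added on the right-hand side. Inscribed polyhedron of a compact convex set: a (convex) polyhedron all of whose vertices lie on the boundary of the set. Assumption A: (i) each $\Omega_i$ is compact and convex; (ii) each $J_i$ is Lipschitz continuous in $\boldsymbol x$, $J_i(\cdot,\boldsymbol x_{-i})$ and $q_i$ are continuously differentiable in $x_i$, and $F$ is $\kappa$-strongly monotone on $\boldsymbol\Omega$ ($\kappa>0$), i.e. $(F(\boldsymbol x)-F(\boldsymbol y))^{\mathrm T}(\boldsymbol x-\boldsymbol y)\ge\kappa\|\boldsymbol x-\boldsymbol y\|^2$; (iii) $U(\boldsymbol x,\boldsymbol\zeta)$ is $c_1$-Lipschitz in $\boldsymbol x\in\boldsymbol\Omega$ and $c_2$-Lipschitz in $\boldsymbol\zeta$, and each $q_i$ is $c_3$-Lipschitz on $\Omega_i$, $c_1,c_2,c_3>0$; (iv) the players communicate over a strongly connected, weight-balanced directed graph on $\mathcal I$ with adjacency matrix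 $A=[a_{ij}]\in\mathbb{R}^{N\times N}$ ($a_{ij}>0$ if $(j,i)$ is an edge, $a_{ij}=0$ otherwise; weight-balanced: $\sum_ja_{ij}=\sum_ja_{ji}$ for all $i$) and Laplacian $L=\mathrm{diag}(\sum_ja_{1j},\dots,\sum_ja_{Nj})-A$. Under Assumption A both games have a unique Nash equilibrium; that of the original game is denoted $\boldsymbol x^*(\boldsymbol\Omega)$. Step-size conditions: with $c=c_1+c_2c_3$ and $\lambda$ the smallest positive eigenvalue of $\frac12(L+L^{\mathrm T})$, $$0<\beta_1<\frac{2\kappa}{c^2},\qquad \beta_2>\frac{2c_2c_3(2+\beta_1\kappa+2\beta_1c)}{\lambda(2\kappa-\beta_1c^2)}.$$ The system: for $\boldsymbol z=\mathrm{col}(\boldsymbol x,\boldsymbol\sigma)\in\mathbb{R}^{nN+MN}$ put $P_{\boldsymbol\Omega}(\boldsymbol z)=\Pi_{\boldsymbol\Omega}\big(\boldsymbol x-\beta_1U(\boldsymbol x,\mathbf 1_N\otimes\mathcal Q(\boldsymbol x)+\boldsymbol\sigma)\big)-\boldsymbol x$ and $$G_{\boldsymbol\Omega}(\boldsymbol z)=\begin{bmatrix}P_{\boldsymbol\Omega}(\boldsymbol z)\\-\beta_2(L\otimes I_M)\boldsymbol\sigma+D\big[\boldsymbol q-\mathbf 1_N\otimes\mathcal Q\big](\boldsymbol x)\,P_{\boldsymbol\Omega}(\boldsymbol z)\end{bmatrix},$$ where $D[\cdot](\boldsymbol x)$ is the Jacobian. The initial conditions are $\boldsymbol x(0)\in\boldsymbol\Omega$,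 $\boldsymbol\sigma(0)=\boldsymbol q(\boldsymbol x(0))-\mathbf 1_N\otimes\mathcal Q(\boldsymbol x(0))$, so trajectories stay in $S=\{(\boldsymbol x,\boldsymbol\sigma):\boldsymbol x\in\boldsymbol\Omega,\ \sum_{i=1}^N\sigma_i=0\}$. The equilibrium is $\boldsymbol z^*(\boldsymbol\Omega)=\mathrm{col}(\boldsymbol x^*(\boldsymbol\Omega),\boldsymbol 0)$. Inequalities (L): $V_{\boldsymbol\Omega}$ is continuously differentiable and, for $\boldsymbol z\in S$, $$a_1\|\boldsymbol z-\boldsymbol z^*(\boldsymbol\Omega)\|^2\le V_{\boldsymbol\Omega}(\boldsymbol z)\le a_2\|\boldsymbol z-\boldsymbol z^*(\boldsymbol\Omega)\|^2,\quad \dot V_{\boldsymbol\Omega}(\boldsymbol z)=\Big(\frac{\partial V_{\boldsymbol\Omega}}{\partial\boldsymbol z}\Big)^{\mathrm T}G_{\boldsymbol\Omega}(\boldsymbol z)\le-a_3\|\boldsymbol z-\boldsymbol z^*(\boldsymbol\Omega)\|^2,\quad \Big\|\frac{\partial V_{\boldsymbol\Omega}}{\partial\boldsymbol z}\Big\|\le a_4\|\boldsymbol z-\boldsymbol z^*(\boldsymbol\Omega)\|.$$ *)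

theory Defs
  imports "HOL-Analysis.Analysis"
begin

text \<open>
  The finite type \<open>'p\<close> is the set of players (so \<open>N = CARD('p)\<close>), strategies live in
  \<open>real^'n\<close> and aggregates in \<open>real^'m\<close>. Stacked vectors \<open>col(x\<^sub>1, \<dots>, x\<^sub>N)\<close> are elements of
  \<open>(real^'n)^'p\<close>, and \<open>col(x, \<sigma>)\<close> is a pair; the library norms on these types
  are the Euclidean norms of the stacked vectors.
\<close>

section \<open>Analysis and convex geometry\<close>

definition gradient :: "('a::real_inner \<Rightarrow> real) \<Rightarrow> 'a \<Rightarrow> 'a"
  where "gradient g x = (THE d. GDERIV g x :> d)"

text \<open>All functions are total, so derivatives at the points of a closed set \<open>S\<close> are derivatives
  in the full space; only their continuity is relative to \<open>S\<close>.\<close>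

definition C1_on :: "('a::real_normed_vector \<Rightarrow> 'b::real_normed_vector) \<Rightarrow> 'a set \<Rightarrow> bool"
  where "C1_on g S \<longleftrightarrow>
    (\<exists>g' :: 'a \<Rightarrow> 'a \<Rightarrow>\<^sub>L 'b.
       (\<forall>x\<in>S. (g has_derivative blinfun_apply (g' x)) (at x)) \<and> continuous_on S g')"

text \<open>Meaningful for nonempty compact sets only, the only case in which it is used.\<close>

definition hausdorff_dist :: "'a::metric_space set \<Rightarrow> 'a set \<Rightarrow> real"
  where "hausdorff_dist A B = max (SUP a\<in>A. infdist a B) (SUP b\<in>B. infdist b A)"

text \<open>The polyhedron is bounded, so it is the convex hull of its vertices; together with the vertex
  condition this gives \<open>D \<subseteq> K\<close> for closed convex \<open>K\<close>.\<close>

definition inscribed_polyhedron :: "(real^'n) set \<Rightarrow> (real^'n) set \<Rightarrow> bool"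
  where "inscribed_polyhedron K D \<longleftrightarrow>
    polytope D \<and> D \<noteq> {} \<and> {v. v extreme_point_of D} \<subseteq> frontier K"

section \<open>Games and Nash equilibria\<close>

definition profiles :: "('p::finite \<Rightarrow> 'a set) \<Rightarrow> ('a^'p) set"
  where "profiles K = {x. \<forall>i. x $ i \<in> K i}"

text \<open>The profile \<open>(y, x\<^bsub>-i\<^esub>)\<close>:\<close>

definition deviate :: "'a^'p::finite \<Rightarrow> 'p \<Rightarrow> 'a \<Rightarrow> 'a^'p"
  where "deviate x i y = (\<chi> j. if j = i then y else x $ j)"

definition is_nash_equilibrium ::
  "('p::finite \<Rightarrow> 'a^'p \<Rightarrow> real) \<Rightarrow> ('p \<Rightarrow> 'a set) \<Rightarrow> 'a^'p \<Rightarrow> bool"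
  where "is_nash_equilibrium J K x \<longleftrightarrow>
    x \<in> profiles K \<and> (\<forall>i. \<forall>y\<in>K i. J i x \<le> J i (deviate x i y))"

definition nash_equilibrium ::
  "('p::finite \<Rightarrow> 'a^'p \<Rightarrow> real) \<Rightarrow> ('p \<Rightarrow> 'a set) \<Rightarrow> 'a^'p"
  where "nash_equilibrium J K = (THE x. is_nash_equilibrium J K x)"

section \<open>Aggregative games\<close>

definition aggregate :: "('p::finite \<Rightarrow> real^'n \<Rightarrow> real^'m) \<Rightarrow> (real^'n)^'p \<Rightarrow> real^'m"
  where "aggregate q x = (1 / real CARD('p)) *\<^sub>R (\<Sum>i\<in>UNIV. q i (x $ i))"

definition payoff ::
  "('p::finite \<Rightarrow> (real^'n) \<times> (real^'m) \<Rightarrow> real) \<Rightarrow> ('p \<Rightarrow> real^'n \<Rightarrow> real^'m) \<Rightarrow>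
   'p \<Rightarrow> (real^'n)^'p \<Rightarrow> real"
  where "payoff f q i x = f i (x $ i, aggregate q x)"

definition pseudo_gradient :: "('p::finite \<Rightarrow> (real^'n)^'p \<Rightarrow> real) \<Rightarrow> (real^'n)^'p \<Rightarrow> (real^'n)^'p"
  where "pseudo_gradient J x = (\<chi> i. gradient (\<lambda>y. J i (deviate x i y)) (x $ i))"

definition U_map ::
  "('p::finite \<Rightarrow> (real^'n) \<times> (real^'m) \<Rightarrow> real) \<Rightarrow> ('p \<Rightarrow> real^'n \<Rightarrow> real^'m) \<Rightarrow>
   (real^'n)^'p \<Rightarrow> (real^'m)^'p \<Rightarrow> (real^'n)^'p"
  where "U_map f q x \<zeta> = (\<chi> i.
     gradient (\<lambda>y. f i (y, \<zeta> $ i)) (x $ i) +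
     (1 / real CARD('p)) *\<^sub>R
       (transpose (jacobian (q i) (at (x $ i))) *v gradient (\<lambda>s. f i (x $ i, s)) (\<zeta> $ i)))"

section \<open>The communication graph\<close>

definition laplacian :: "real^'p^'p::finite \<Rightarrow> real^'p^'p"
  where "laplacian A = (\<chi> i j. (if i = j then \<Sum>k\<in>UNIV. A $ i $ k else 0) - A $ i $ j)"

definition adjacency_matrix_of :: "('p::finite \<times> 'p) set \<Rightarrow> real^'p^'p \<Rightarrow> bool"
  where "adjacency_matrix_of E A \<longleftrightarrow>
    (\<forall>i j. if (j, i) \<in> E then A $ i $ j > 0 else A $ i $ j = 0)"

definition strongly_connected :: "('p \<times> 'p) set \<Rightarrow> bool"
  where "strongly_connected E \<longleftrightarrow> (\<forall>i j. (i, j) \<in> E\<^sup>*)"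

definition weight_balanced :: "real^'p^'p::finite \<Rightarrow> bool"
  where "weight_balanced A \<longleftrightarrow> (\<forall>i. (\<Sum>j\<in>UNIV. A $ i $ j) = (\<Sum>j\<in>UNIV. A $ j $ i))"

definition eigenvalues :: "real^'p^'p::finite \<Rightarrow> real set"
  where "eigenvalues B = {l. \<exists>v. v \<noteq> 0 \<and> B *v v = l *\<^sub>R v}"

definition smallest_positive_eigenvalue :: "real^'p^'p::finite \<Rightarrow> real \<Rightarrow> bool"
  where "smallest_positive_eigenvalue B l \<longleftrightarrow>
    l \<in> eigenvalues B \<and> 0 < l \<and> (\<forall>l'\<in>eigenvalues B. 0 < l' \<longrightarrow> l \<le> l')"

section \<open>Standing assumptions and step sizes\<close>

text \<open>Differentiability of \<open>f i\<close> is what makes the partial gradients in \<^const>\<open>U_map\<close>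
  exist and the chain rule identify the pseudo-gradient with \<^const>\<open>U_map\<close> at the true
  aggregate.\<close>

definition standing_assumptions ::
  "('p::finite \<Rightarrow> (real^'n) set) \<Rightarrow> ('p \<Rightarrow> (real^'n) \<times> (real^'m) \<Rightarrow> real) \<Rightarrow>
   ('p \<Rightarrow> real^'n \<Rightarrow> real^'m) \<Rightarrow> real \<Rightarrow> real \<Rightarrow> real \<Rightarrow> real \<Rightarrow> ('p \<times> 'p) set \<Rightarrow> real^'p^'p \<Rightarrow> bool"
  where "standing_assumptions \<Omega> f q \<kappa> c1 c2 c3 E A \<longleftrightarrow>
    (let J = payoff f q; F = pseudo_gradient J in
    (\<forall>i. compact (\<Omega> i) \<and> convex (\<Omega> i) \<and> \<Omega> i \<noteq> {}) \<and>
    (\<forall>i. \<exists>C. C-lipschitz_on (profiles \<Omega>) (J i)) \<and>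
    (\<forall>i. \<forall>x\<in>profiles \<Omega>. C1_on (\<lambda>y. J i (deviate x i y)) (\<Omega> i)) \<and>
    (\<forall>i. C1_on (q i) (\<Omega> i)) \<and>
    0 < \<kappa> \<and>
    (\<forall>x\<in>profiles \<Omega>. \<forall>y\<in>profiles \<Omega>. (F x - F y) \<bullet> (x - y) \<ge> \<kappa> * (norm (x - y))\<^sup>2) \<and>
    (\<forall>i. \<forall>y\<in>\<Omega> i. \<forall>s. f i differentiable (at (y, s))) \<and>
    0 < c1 \<and> 0 < c2 \<and> 0 < c3 \<and>
    (\<forall>\<zeta>. c1-lipschitz_on (profiles \<Omega>) (\<lambda>x. U_map f q x \<zeta>)) \<and>
    (\<forall>x\<in>profiles \<Omega>. c2-lipschitz_on UNIV (U_map f q x)) \<and>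
    (\<forall>i. c3-lipschitz_on (\<Omega> i) (q i)) \<and>
    strongly_connected E \<and> adjacency_matrix_of E A \<and> weight_balanced A)"

definition step_sizes ::
  "real \<Rightarrow> real \<Rightarrow> real \<Rightarrow> real \<Rightarrow> real^'p^'p::finite \<Rightarrow> real \<Rightarrow> real \<Rightarrow> bool"
  where "step_sizes \<kappa> c1 c2 c3 L \<beta>1 \<beta>2 \<longleftrightarrow>
    (let c = c1 + c2 * c3 in
     \<exists>l. smallest_positive_eigenvalue ((1/2) *\<^sub>R (L + transpose L)) l \<and>
       0 < \<beta>1 \<and> \<beta>1 < 2 * \<kappa> / c\<^sup>2 \<and>
       \<beta>2 > 2 * c2 * c3 * (2 + \<beta>1 * \<kappa> + 2 * \<beta>1 * c) / (l * (2 * \<kappa> - \<beta>1 * c\<^sup>2)))"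

section \<open>The dynamical system and its Lyapunov function\<close>

definition P_field ::
  "('p::finite \<Rightarrow> (real^'n) set) \<Rightarrow> ('p \<Rightarrow> (real^'n) \<times> (real^'m) \<Rightarrow> real) \<Rightarrow>
   ('p \<Rightarrow> real^'n \<Rightarrow> real^'m) \<Rightarrow> real \<Rightarrow> ((real^'n)^'p) \<times> ((real^'m)^'p) \<Rightarrow> (real^'n)^'p"
  where "P_field \<Omega> f q \<beta>1 = (\<lambda>(x, \<sigma>).
    closest_point (profiles \<Omega>) (x - \<beta>1 *\<^sub>R U_map f q x ((\<chi> i. aggregate q x) + \<sigma>)) - x)"

text \<open>The Jacobian of \<open>q - 1\<^sub>N \<otimes> \<Q>\<close> enters only through its product with a vector, i.e. as the
  Frechet derivative; the inner sum is \<open>(L \<otimes> I\<^sub>M) \<sigma>\<close> written blockwise.\<close>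

definition G_field ::
  "('p::finite \<Rightarrow> (real^'n) set) \<Rightarrow> ('p \<Rightarrow> (real^'n) \<times> (real^'m) \<Rightarrow> real) \<Rightarrow>
   ('p \<Rightarrow> real^'n \<Rightarrow> real^'m) \<Rightarrow> real^'p^'p \<Rightarrow> real \<Rightarrow> real \<Rightarrow>
   ((real^'n)^'p) \<times> ((real^'m)^'p) \<Rightarrow> ((real^'n)^'p) \<times> ((real^'m)^'p)"
  where "G_field \<Omega> f q L \<beta>1 \<beta>2 = (\<lambda>(x, \<sigma>).
    (P_field \<Omega> f q \<beta>1 (x, \<sigma>),
     - \<beta>2 *\<^sub>R (\<chi> i. \<Sum>j\<in>UNIV. L $ i $ j *\<^sub>R \<sigma> $ j) +
     frechet_derivative (\<lambda>y. \<chi> i. q i (y $ i) - aggregate q y) (at x)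
       (P_field \<Omega> f q \<beta>1 (x, \<sigma>))))"

definition state_set :: "('p::finite \<Rightarrow> (real^'n) set) \<Rightarrow> (((real^'n)^'p) \<times> ((real^'m)^'p)) set"
  where "state_set \<Omega> = {(x, \<sigma>). x \<in> profiles \<Omega> \<and> (\<Sum>i\<in>UNIV. \<sigma> $ i) = 0}"

definition lyapunov_inequalities ::
  "('z::real_inner \<Rightarrow> real) \<Rightarrow> ('z \<Rightarrow> 'z) \<Rightarrow> 'z set \<Rightarrow> 'z \<Rightarrow> real \<Rightarrow> real \<Rightarrow> real \<Rightarrow> real \<Rightarrow> bool"
  where "lyapunov_inequalities V G S z\<^sub>e a1 a2 a3 a4 \<longleftrightarrow>
    C1_on V S \<and>
    (\<forall>z\<in>S. a1 * (norm (z - z\<^sub>e))\<^sup>2 \<le> V z \<and> V z \<le> a2 * (norm (z - z\<^sub>e))\<^sup>2 \<and>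
           gradient V z \<bullet> G z \<le> - a3 * (norm (z - z\<^sub>e))\<^sup>2 \<and>
           norm (gradient V z) \<le> a4 * norm (z - z\<^sub>e))"

definition delta :: "real \<Rightarrow> ('p::finite \<Rightarrow> real) \<Rightarrow> ('p \<Rightarrow> real) \<Rightarrow> real"
  where "delta c3 \<nu> h =
    (1 + c3) * sqrt (\<Sum>i\<in>UNIV. (2 / \<nu> i * arccos (1 - \<nu> i * h i) + h i)\<^sup>2)"

end

theory Submission
  imports Defs
begin

text \<open>
  Projecting a deviation \<open>y \<in> \<Omega>\<^sub>i\<close> to \<open>D\<^sub>i\<close> changes \<open>J\<^sub>i\<close> by at most \<open>\<rho>\<^sub>i h\<^sub>i\<close>, so the equilibrium of
  the approximate game is within \<open>\<rho>\<^sub>i h\<^sub>i\<close> of being optimal for player \<open>i\<close>; and \<open>\<delta> \<ge> (1 + c\<^sub>3) h\<^sub>i\<close>.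
  It remains to see that \<open>2 (1 + c\<^sub>3) a\<^sub>4 \<ge> a\<^sub>3\<close> and \<open>a\<^sub>2 \<ge> a\<^sub>1\<close> as soon as \<open>\<Omega>\<close> has two points. For this the
  inequalities (L) are evaluated at a state \<open>(x, 0)\<close>, \<open>x \<noteq> x\<^sup>*\<close>: there the field has norm at most
  \<open>(1 + c\<^sub>3) \<parallel>P\<parallel> \<le> 2 (1 + c\<^sub>3) \<parallel>x - x\<^sup>*\<parallel>\<close>, because \<open>x \<mapsto> \<Pi>(x - \<beta>\<^sub>1 F x)\<close> is a contraction with
  fixed point \<open>x\<^sup>*\<close>. The same contraction yields existence of the equilibria. The constants \<open>\<nu>\<^sub>i\<close> only
  have to keep \<open>\<nu>\<^sub>i h\<^sub>i\<close> in the domain of \<open>arccos\<close>.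
\<close>

section \<open>Variational inequalities\<close>

text \<open>The variational inequality of Stampacchia. Taken for the pseudo-gradient on a product
  set, it replaces the N coupled minimisations of a game by a condition on a single map.\<close>

definition vi_solution :: "('a::real_inner \<Rightarrow> 'a) \<Rightarrow> 'a set \<Rightarrow> 'a \<Rightarrow> bool"
  where "vi_solution F K x \<longleftrightarrow> x \<in> K \<and> (\<forall>y\<in>K. 0 \<le> F x \<bullet> (y - x))"

text \<open>Both directions rest on the obtuse-angle property of the projection onto a convex set.
  Any positive step length works, so the step can later be chosen to make the map a
  contraction.\<close>

lemma vi_solution_iff_fixed_point:
  fixes F :: "'a::euclidean_space \<Rightarrow> 'a"
  assumes "closed K" "convex K" "x \<in> K" "0 < \<beta>"
  shows "vi_solution F K x \<longleftrightarrow> closest_point K (x - \<beta> *\<^sub>R F x) = x"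
proof
  assume vi: "vi_solution F K x"
  define p where "p = closest_point K (x - \<beta> *\<^sub>R F x)"
  have "p \<in> K"
    using assms closest_point_in_set unfolding p_def by blast
  then have "0 \<le> \<beta> * (F x \<bullet> (p - x))"
    using vi assms(4) by (simp add: vi_solution_def)
  moreover have "(x - \<beta> *\<^sub>R F x - p) \<bullet> (x - p) \<le> 0"
    unfolding p_def by (rule closest_point_dot[OF assms(2,1,3)])
  \<comment> \<open>The obtuse angle at \<open>p\<close>, tested with \<open>x\<close>, bounds the
    squared distance by \<open>\<beta> * (F x \<bullet> (x - p))\<close>, which the variational
    inequality tested with \<open>p\<close> makes nonpositive.\<close>
  ultimately have "(x - p) \<bullet> (x - p) \<le> 0"
    by (simp add: algebra_simps)
  then have "x - p = 0"
    by (metis inner_eq_zero_iff inner_ge_zero order_antisym)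
  then show "closest_point K (x - \<beta> *\<^sub>R F x) = x"
    by (simp add: p_def)
next
  assume fp: "closest_point K (x - \<beta> *\<^sub>R F x) = x"
  have "0 \<le> F x \<bullet> (y - x)" if "y \<in> K" for y
  proof -
    have "(x - \<beta> *\<^sub>R F x - x) \<bullet> (y - x) \<le> 0"
      using closest_point_dot[OF assms(2,1) that, of "x - \<beta> *\<^sub>R F x"] fp by simp
    then show ?thesis
      using assms(4) by (simp add: zero_le_mult_iff)
  qed
  then show "vi_solution F K x"
    using assms(3) by (simp add: vi_solution_def)
qed

text \<open>Each solution is tested against the other; the sum of the two inequalities contradicts
  strong monotonicity unless the points coincide.\<close>

lemma vi_solution_unique:
  assumes "0 < \<kappa>" "\<And>x y. x \<in> K \<Longrightarrow> y \<in> K \<Longrightarrow> \<kappa> * (norm (x - y))\<^sup>2 \<le> (F x - F y) \<bullet> (x - y)"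
    and "vi_solution F K x" "vi_solution F K y"
  shows "x = y"
proof -
  have "\<kappa> * (norm (x - y))\<^sup>2 \<le> (F x - F y) \<bullet> (x - y)"
    using assms by (auto simp: vi_solution_def)
  moreover have "0 \<le> F x \<bullet> (y - x)" "0 \<le> F y \<bullet> (x - y)"
    using assms by (auto simp: vi_solution_def)
  ultimately have "\<kappa> * (norm (x - y))\<^sup>2 \<le> 0"
    by (simp add: inner_diff_left inner_diff_right)
  then show ?thesis
    using assms(1) by (simp add: mult_le_0_iff)
qed

text \<open>Projection is nonexpansive, so only the unprojected step has to contract. In the
  expanded square, monotonicity controls the cross term and the Lipschitz bound the last one. If
  \<open>x \<noteq> y\<close>, Cauchy-Schwarz gives \<kappa> \<le> c and the factor is nonnegative;
  \<open>max 0\<close> covers the degenerate case \<open>x = y\<close>, where it may be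
  negative.\<close>

lemma projected_step_contraction:
  fixes F :: "'a::euclidean_space \<Rightarrow> 'a"
  assumes "closed K" "convex K" and xy: "x \<in> K" "y \<in> K" and "0 < \<beta>" "0 < c" "\<beta> < 2 * \<kappa> / c\<^sup>2"
    and mono: "\<kappa> * (norm (x - y))\<^sup>2 \<le> (F x - F y) \<bullet> (x - y)"
    and lip: "norm (F x - F y) \<le> c * norm (x - y)"
  shows "dist (closest_point K (x - \<beta> *\<^sub>R F x)) (closest_point K (y - \<beta> *\<^sub>R F y))
    \<le> sqrt (max 0 (1 - \<beta> * (2 * \<kappa> - \<beta> * c\<^sup>2))) * dist x y"
proof -
  let ?m = "max 0 (1 - \<beta> * (2 * \<kappa> - \<beta> * c\<^sup>2))"
  have "dist (closest_point K (x - \<beta> *\<^sub>R F x)) (closest_point K (y - \<beta> *\<^sub>R F y))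
      \<le> dist (x - \<beta> *\<^sub>R F x) (y - \<beta> *\<^sub>R F y)"
    using assms by (intro closest_point_lipschitz) auto
  also have "\<dots> \<le> sqrt ?m * norm (x - y)"
  proof (rule power2_le_imp_le)
    have "(dist (x - \<beta> *\<^sub>R F x) (y - \<beta> *\<^sub>R F y))\<^sup>2 = (norm ((x - y) - \<beta> *\<^sub>R (F x - F y)))\<^sup>2"
      by (simp add: dist_norm algebra_simps)
    also have "\<dots> = (norm (x - y))\<^sup>2 - 2 * \<beta> * ((F x - F y) \<bullet> (x - y)) + \<beta>\<^sup>2 * (norm (F x - F y))\<^sup>2"
      unfolding power2_norm_eq_inner by (simp add: inner_commute power2_eq_square algebra_simps)
    also have "\<dots> \<le> (norm (x - y))\<^sup>2 - 2 * \<beta> * (\<kappa> * (norm (x - y))\<^sup>2) + \<beta>\<^sup>2 * (c * norm (x - y))\<^sup>2"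
      using mono lip \<open>0 < \<beta>\<close> by (intro add_mono diff_mono mult_left_mono power_mono) auto
    also have "\<dots> = (1 - \<beta> * (2 * \<kappa> - \<beta> * c\<^sup>2)) * (norm (x - y))\<^sup>2"
      by (simp add: power2_eq_square algebra_simps)
    also have "\<dots> \<le> ?m * (norm (x - y))\<^sup>2"
      by (intro mult_right_mono) auto
    finally show "(dist (x - \<beta> *\<^sub>R F x) (y - \<beta> *\<^sub>R F y))\<^sup>2 \<le> (sqrt ?m * norm (x - y))\<^sup>2"
      by (simp add: power_mult_distrib)
  qed simp
  finally show ?thesis
    by (simp add: dist_norm)
qed

lemma contraction_factor_less_one:
  fixes \<beta> c \<kappa> :: real
  assumes "0 < \<beta>" "0 < c" "\<beta> < 2 * \<kappa> / c\<^sup>2"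
  shows "sqrt (max 0 (1 - \<beta> * (2 * \<kappa> - \<beta> * c\<^sup>2))) < 1"
proof -
  have "0 < \<beta> * (2 * \<kappa> - \<beta> * c\<^sup>2)"
    using assms by (simp add: field_simps)
  then show ?thesis
    by simp
qed

lemma vi_solution_exists:
  fixes F :: "'a::euclidean_space \<Rightarrow> 'a"
  assumes K: "closed K" "convex K" "K \<noteq> {}" and \<beta>: "0 < \<beta>" "0 < c" "\<beta> < 2 * \<kappa> / c\<^sup>2"
    and "\<And>x y. x \<in> K \<Longrightarrow> y \<in> K \<Longrightarrow> \<kappa> * (norm (x - y))\<^sup>2 \<le> (F x - F y) \<bullet> (x - y)"
    and "\<And>x y. x \<in> K \<Longrightarrow> y \<in> K \<Longrightarrow> norm (F x - F y) \<le> c * norm (x - y)"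
  shows "\<exists>x. vi_solution F K x"
proof -
  have "\<exists>!x. x \<in> K \<and> closest_point K (x - \<beta> *\<^sub>R F x) = x"
  proof (rule Banach_fix)
    show "sqrt (max 0 (1 - \<beta> * (2 * \<kappa> - \<beta> * c\<^sup>2))) < 1"
      using \<beta> by (rule contraction_factor_less_one)
    show "(\<lambda>x. closest_point K (x - \<beta> *\<^sub>R F x)) ` K \<subseteq> K"
      using K closest_point_in_set by blast
  qed (use K in \<open>auto intro!: projected_step_contraction assms simp: complete_eq_closed\<close>)
  then show ?thesis
    using vi_solution_iff_fixed_point[OF K(1,2) _ \<beta>(1)] by blast
qed

text \<open>The step keeps the fixed point \<open>x'\<close> and does not increase the distance to
  it, so the triangle inequality through \<open>x'\<close> gives the factor 2.\<close>

lemma projected_step_norm_le: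
  fixes F :: "'a::euclidean_space \<Rightarrow> 'a"
  assumes K: "closed K" "convex K" and \<beta>: "0 < \<beta>" "0 < c" "\<beta> < 2 * \<kappa> / c\<^sup>2"
    and mono: "\<And>x y. x \<in> K \<Longrightarrow> y \<in> K \<Longrightarrow> \<kappa> * (norm (x - y))\<^sup>2 \<le> (F x - F y) \<bullet> (x - y)"
    and lip: "\<And>x y. x \<in> K \<Longrightarrow> y \<in> K \<Longrightarrow> norm (F x - F y) \<le> c * norm (x - y)"
    and "vi_solution F K x'" "x \<in> K"
  shows "norm (closest_point K (x - \<beta> *\<^sub>R F x) - x) \<le> 2 * norm (x - x')"
proof -
  have x': "x' \<in> K" "closest_point K (x' - \<beta> *\<^sub>R F x') = x'"
    using assms vi_solution_iff_fixed_point[OF K _ \<beta>(1), of x' F] by (auto simp: vi_solution_def)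
  have "dist (closest_point K (x - \<beta> *\<^sub>R F x)) x'
      \<le> sqrt (max 0 (1 - \<beta> * (2 * \<kappa> - \<beta> * c\<^sup>2))) * dist x x'"
    using projected_step_contraction[OF K \<open>x \<in> K\<close> x'(1) \<beta>, of F] mono lip x' \<open>x \<in> K\<close> by simp
  also have "\<dots> \<le> 1 * dist x x'"
    using contraction_factor_less_one[OF \<beta>] by (intro mult_right_mono) auto
  finally have "dist (closest_point K (x - \<beta> *\<^sub>R F x)) x' \<le> dist x x'"
    by simp
  then have "dist (closest_point K (x - \<beta> *\<^sub>R F x)) x \<le> 2 * dist x x'"
    using dist_triangle[of "closest_point K (x - \<beta> *\<^sub>R F x)" x x'] by (simp add: dist_commute)
  then show ?thesis
    by (simp add: dist_norm)
qed

section \<open>Gradients and derivatives\<close>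

lemma gradient_eq:
  assumes "GDERIV g x :> d"
  shows "gradient g x = d"
  unfolding gradient_def
proof (rule the_equality)
  fix d' assume "GDERIV g x :> d'"
  with assms have "(\<lambda>h. h \<bullet> d') = (\<lambda>h. h \<bullet> d)"
    unfolding gderiv_def by (rule has_derivative_unique[rotated])
  then show "d' = d"
    by (metis inner_commute vector_eq_rdot)
qed (rule assms)

lemma GDERIV_gradient:
  fixes g :: "'a::euclidean_space \<Rightarrow> real"
  assumes "(g has_derivative g') (at x)"
  shows "GDERIV g x :> gradient g x"
proof -
  have "linear g'"
    using assms by (rule has_derivative_linear)
  \<comment> \<open>The Riesz vector of a linear form is its adjoint applied to 1.\<close>
  then have "g' = (\<lambda>h. h \<bullet> adjoint g' 1)"
    by (auto simp: adjoint_works)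
  then have "GDERIV g x :> adjoint g' 1"
    using assms unfolding gderiv_def by metis
  then show ?thesis
    using gradient_eq by metis
qed

lemma has_derivative_vec_lambda:
  fixes g :: "'i::finite \<Rightarrow> 'a::real_normed_vector \<Rightarrow> 'b::euclidean_space"
  assumes "\<And>i. (g i has_derivative g' i) (at x within S)"
  shows "((\<lambda>x. \<chi> i. g i x) has_derivative (\<lambda>h. \<chi> i. g' i h)) (at x within S)"
proof (subst has_derivative_componentwise_within, intro ballI)
  fix b :: "'b^'i" assume "b \<in> Basis"
  then obtain i u where "b = axis i u"
    by (auto simp: Basis_vec_def)
  then show "((\<lambda>x. (\<chi> i. g i x) \<bullet> b) has_derivative (\<lambda>x. (\<chi> i. g' i x) \<bullet> b)) (at x within S)"
    by (simp add: inner_axis has_derivative_inner_left assms)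
qed

text \<open>The Lipschitz bound is known on \<open>K\<close> only, where \<open>x\<close> may be a
  boundary point, so the derivative is controlled just in directions that stay in \<open>K\<close>.
  One-sided difference quotients along the segment from \<open>x\<close> to \<open>x + v\<close>
  suffice for these.\<close>

lemma lipschitz_on_derivative_norm_le:
  fixes g :: "'a::real_normed_vector \<Rightarrow> 'b::real_normed_vector"
  assumes lip: "c-lipschitz_on K g" and "convex K" "x \<in> K" "x + v \<in> K"
    and der: "(g has_derivative g') (at x)"
  shows "norm (g' v) \<le> c * norm v"
proof -
  let ?\<phi> = "\<lambda>t::real. g (x + t *\<^sub>R v)"
  interpret g': bounded_linear g'
    using der by (rule has_derivative_bounded_linear)
  have "(?\<phi> has_derivative (\<lambda>t. g' (t *\<^sub>R v))) (at_right 0)"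
    by (rule has_derivative_compose[where g = g])
      (auto intro!: derivative_eq_intros simp: der)
  then have "((\<lambda>t. norm (?\<phi> t - ?\<phi> 0 - g' ((t - 0) *\<^sub>R v)) / norm (t - 0)) \<longlongrightarrow> 0) (at_right 0)"
    unfolding has_derivative_iff_norm by blast
  then have lim: "((\<lambda>t. norm (?\<phi> t - ?\<phi> 0 - g' ((t - 0) *\<^sub>R v)) / norm (t - 0) + c * norm v)
      \<longlongrightarrow> 0 + c * norm v) (at_right 0)"
    by (intro tendsto_intros)
  have "norm (g' v) \<le> norm (?\<phi> t - ?\<phi> 0 - g' ((t - 0) *\<^sub>R v)) / norm (t - 0) + c * norm v"
    if "t \<in> {0<..<1}" for t
  proof -
    have "x + t *\<^sub>R v = (1 - t) *\<^sub>R x + t *\<^sub>R (x + v)"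
      by (simp add: algebra_simps)
    then have "x + t *\<^sub>R v \<in> K"
      using assms that by (auto simp: convex_alt)
    then have "norm (?\<phi> t - ?\<phi> 0) \<le> c * (t * norm v)"
      using lipschitz_onD[OF lip, of "x + t *\<^sub>R v" x] \<open>x \<in> K\<close> that by (simp add: dist_norm)
    moreover have "t * norm (g' v) \<le> norm (?\<phi> t - ?\<phi> 0 - g' (t *\<^sub>R v)) + norm (?\<phi> t - ?\<phi> 0)"
      using norm_triangle_ineq4[of "?\<phi> t - ?\<phi> 0" "?\<phi> t - ?\<phi> 0 - g' (t *\<^sub>R v)"] that
      by (simp add: g'.scaleR)
    ultimately show ?thesis
      using that by (simp add: field_simps)
  qed
  then have "\<forall>\<^sub>F t in at_right 0.
      norm (g' v) \<le> norm (?\<phi> t - ?\<phi> 0 - g' ((t - 0) *\<^sub>R v)) / norm (t - 0) + c * norm v"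
    using eventually_at_right_real[of 0 1] by (auto elim: eventually_mono)
  then have "norm (g' v) \<le> 0 + c * norm v"
    by (rule tendsto_lowerbound[OF lim]) simp
  then show ?thesis
    by simp
qed

section \<open>Stacked vectors\<close>

lemma norm_vec_le_mult:
  fixes x :: "'a::real_normed_vector^'i" and y :: "'b::real_normed_vector^'i"
  assumes "0 \<le> c" "\<And>i. norm (x $ i) \<le> c * norm (y $ i)"
  shows "norm x \<le> c * norm y"
proof -
  have "norm x \<le> L2_set (\<lambda>i. c * norm (y $ i)) UNIV"
    unfolding norm_vec_def by (intro L2_set_mono assms) auto
  then show ?thesis
    using assms(1) by (simp add: norm_vec_def L2_set_right_distrib)
qed

text \<open>Averaging is the orthogonal projection onto the consensus subspace. By Pythagoras
  neither the mean part nor the deviation from the mean is longer than \<open>w\<close>; in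
  particular no factor depending on the number of players arises.\<close>

lemma norm_mean_vec_le:
  fixes w :: "'a::real_inner^'i"
  shows "norm (\<chi> i::'i. (1 / real CARD('i)) *\<^sub>R (\<Sum>j\<in>UNIV. w $ j)) \<le> norm w"
    and "norm (\<chi> i::'i. w $ i - (1 / real CARD('i)) *\<^sub>R (\<Sum>j\<in>UNIV. w $ j)) \<le> norm w"
proof -
  define m where "m = (1 / real CARD('i)) *\<^sub>R (\<Sum>j\<in>UNIV. w $ j)"
  have sum: "(\<Sum>j\<in>UNIV. w $ j) = real CARD('i) *\<^sub>R m"
    by (simp add: m_def)
  have "(\<Sum>i\<in>UNIV. w $ i \<bullet> m) = real CARD('i) * (m \<bullet> m)"
    by (simp add: sum flip: inner_sum_left)
  then have "(norm (\<chi> i. w $ i - m))\<^sup>2 = (norm w)\<^sup>2 - (norm (\<chi> i::'i. m))\<^sup>2"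
    unfolding power2_norm_eq_inner
    by (simp add: inner_vec_def inner_diff_left inner_diff_right sum.distrib sum_subtractf
        inner_commute flip: sum_distrib_left)
  then have "(norm (\<chi> i. w $ i - m))\<^sup>2 + (norm (\<chi> i::'i. m))\<^sup>2 = (norm w)\<^sup>2"
    by simp
  then have "(norm (\<chi> i. w $ i - m))\<^sup>2 \<le> (norm w)\<^sup>2" "(norm (\<chi> i::'i. m))\<^sup>2 \<le> (norm w)\<^sup>2"
    using zero_le_power2[of "norm (\<chi> i. w $ i - m)"] zero_le_power2[of "norm (\<chi> i::'i. m)"]
    by linarith+
  then show "norm (\<chi> i::'i. (1 / real CARD('i)) *\<^sub>R (\<Sum>j\<in>UNIV. w $ j)) \<le> norm w"
    "norm (\<chi> i::'i. w $ i - (1 / real CARD('i)) *\<^sub>R (\<Sum>j\<in>UNIV. w $ j)) \<le> norm w"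
    by (auto simp: m_def power2_le_iff_abs_le)
qed

lemma closed_profiles:
  assumes "\<And>i. closed (K i)"
  shows "closed (profiles K)"
proof -
  have "profiles K = (\<Inter>i. (\<lambda>x. x $ i) -` K i)"
    by (auto simp: profiles_def)
  then show ?thesis
    by (auto intro!: closed_INT closed_vimage assms continuous_intros)
qed

lemma convex_profiles:
  assumes "\<And>i. convex (K i)"
  shows "convex (profiles K)"
  using assms unfolding convex_def profiles_def by simp

lemma profiles_nonempty:
  assumes "\<And>i. K i \<noteq> {}"
  shows "profiles K \<noteq> {}"
proof -
  have "(\<chi> i. SOME y. y \<in> K i) \<in> profiles K"
    using assms by (auto simp: profiles_def some_in_eq)
  then show ?thesis
    by blast
qed

lemma profiles_mono:
  assumes "\<And>i. K i \<subseteq> K' i"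
  shows "profiles K \<subseteq> profiles K'"
  using assms by (auto simp: profiles_def)

lemma deviate_nth: "deviate x i y $ j = (if j = i then y else x $ j)"
  by (simp add: deviate_def)

lemma deviate_self [simp]: "deviate x i (x $ i) = x"
  by (simp add: vec_eq_iff deviate_nth)

lemma deviate_deviate [simp]: "deviate (deviate x i y) i z = deviate x i z"
  by (simp add: vec_eq_iff deviate_nth)

lemma deviate_in_profiles:
  assumes "x \<in> profiles K" "y \<in> K i"
  shows "deviate x i y \<in> profiles K"
  using assms by (simp add: profiles_def deviate_nth)

lemma deviate_diff:
  fixes x :: "'a::ab_group_add^'i"
  shows "deviate x i y - deviate x i z = axis i (y - z)"
  by (simp add: vec_eq_iff deviate_nth axis_def)

section \<open>Nash equilibria of strongly monotone games\<close>

text \<open>Isolates what the equivalence of equilibria and variational inequalities uses, so that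
  the original and the polyhedral game are treated alike.\<close>

locale monotone_game =
  fixes J :: "'p::finite \<Rightarrow> (real^'n)^'p \<Rightarrow> real" and \<Omega> :: "'p \<Rightarrow> (real^'n) set" and \<kappa> :: real
  assumes \<kappa>_pos: "0 < \<kappa>"
    and C1_J: "\<And>i x. x \<in> profiles \<Omega> \<Longrightarrow> C1_on (\<lambda>y. J i (deviate x i y)) (\<Omega> i)"
    and monotone: "\<And>x y. x \<in> profiles \<Omega> \<Longrightarrow> y \<in> profiles \<Omega> \<Longrightarrow>
      \<kappa> * (norm (x - y))\<^sup>2 \<le> (pseudo_gradient J x - pseudo_gradient J y) \<bullet> (x - y)"
begin

lemma J_has_derivative:
  assumes "x \<in> profiles \<Omega>" "y \<in> \<Omega> i"
  shows "((\<lambda>y. J i (deviate x i y)) has_derivative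
    (\<lambda>h. h \<bullet> pseudo_gradient J (deviate x i y) $ i)) (at y)"
proof -
  obtain g' where "((\<lambda>y. J i (deviate x i y)) has_derivative g') (at y)"
    using C1_J[OF assms(1), of i] assms(2) unfolding C1_on_def by blast
  then have "GDERIV (\<lambda>y. J i (deviate x i y)) y :> gradient (\<lambda>y. J i (deviate x i y)) y"
    by (rule GDERIV_gradient)
  then show ?thesis
    by (simp add: gderiv_def pseudo_gradient_def deviate_nth)
qed

lemma J_line_derivative:
  assumes "x \<in> profiles \<Omega>" "y + t *\<^sub>R v \<in> \<Omega> i"
  shows "((\<lambda>t. J i (deviate x i (y + t *\<^sub>R v))) has_real_derivative
    v \<bullet> pseudo_gradient J (deviate x i (y + t *\<^sub>R v)) $ i) (at t)"
proof -
  have "((\<lambda>t. J i (deviate x i (y + t *\<^sub>R v))) has_derivative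
      (\<lambda>s. (s *\<^sub>R v) \<bullet> pseudo_gradient J (deviate x i (y + t *\<^sub>R v)) $ i)) (at t)"
    by (rule has_derivative_compose[where g = "\<lambda>y. J i (deviate x i y)" and f = "\<lambda>t. y + t *\<^sub>R v"])
      (rule J_has_derivative[OF assms] derivative_eq_intros refl | simp)+
  then show ?thesis
    by (simp add: has_field_derivative_def mult_commute_abs)
qed

section \<open>Equilibria on products of convex subsets of the feasible sets\<close>

context
  fixes K :: "'p \<Rightarrow> (real^'n) set"
  assumes K: "\<And>i. convex (K i)" "\<And>i. K i \<subseteq> \<Omega> i"
begin

lemma segment_in_K:
  assumes "x \<in> K i" "y \<in> K i" "0 \<le> t" "t \<le> 1"
  shows "x + t *\<^sub>R (y - x) \<in> K i"
proof -
  have "x + t *\<^sub>R (y - x) = (1 - t) *\<^sub>R x + t *\<^sub>R y"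
    by (simp add: algebra_simps)
  then show ?thesis
    using K(1)[of i] assms by (simp add: convex_alt)
qed

text \<open>First-order optimality, player by player: a negative slope towards \<open>y $ i\<close>
  would let player \<open>i\<close> improve by a short move inside \<open>K i\<close>. Summing over
  the players gives the inequality.\<close>

lemma nash_equilibrium_imp_vi_solution:
  assumes "is_nash_equilibrium J K x"
  shows "vi_solution (pseudo_gradient J) (profiles K) x"
  unfolding vi_solution_def
proof (intro conjI ballI)
  show xK: "x \<in> profiles K"
    using assms by (simp add: is_nash_equilibrium_def)
  fix y assume yK: "y \<in> profiles K"
  have "0 \<le> pseudo_gradient J x $ i \<bullet> (y $ i - x $ i)" for i
  proof (rule ccontr)
    assume neg: "\<not> ?thesis"
    let ?v = "y $ i - x $ i"
    have xy: "x $ i \<in> K i" "y $ i \<in> K i"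
      using xK yK by (auto simp: profiles_def)
    have "x \<in> profiles \<Omega>"
      using xK profiles_mono[of K \<Omega>, OF K(2)] by blast
    then have "((\<lambda>t. J i (deviate x i (x $ i + t *\<^sub>R ?v))) has_real_derivative
        ?v \<bullet> pseudo_gradient J (deviate x i (x $ i + 0 *\<^sub>R ?v)) $ i) (at 0)"
      by (rule J_line_derivative) (use xy K(2) in auto)
    moreover have "?v \<bullet> pseudo_gradient J (deviate x i (x $ i + 0 *\<^sub>R ?v)) $ i < 0"
      using neg by (simp add: inner_commute)
    ultimately have "\<exists>d>0. \<forall>t>0. t < d \<longrightarrow>
        J i (deviate x i (x $ i + (0 + t) *\<^sub>R ?v)) < J i (deviate x i (x $ i + 0 *\<^sub>R ?v))"
      by (rule DERIV_neg_dec_right)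
    then obtain d where d: "0 < d"
      "\<And>t. 0 < t \<Longrightarrow> t < d \<Longrightarrow> J i (deviate x i (x $ i + t *\<^sub>R ?v)) < J i x"
      by auto
    \<comment> \<open>The move must be shorter than \<open>d\<close> to lower the payoff and at most
      1 to stay on the segment.\<close>
    define t where "t = min 1 (d / 2)"
    have t: "0 < t" "t < d" "t \<le> 1"
      using d(1) by (auto simp: t_def)
    have "J i x \<le> J i (deviate x i (x $ i + t *\<^sub>R ?v))"
      using assms segment_in_K[OF xy, of t] t by (simp add: is_nash_equilibrium_def)
    then show False
      using d(2)[OF t(1,2)] by simp
  qed
  then show "0 \<le> pseudo_gradient J x \<bullet> (y - x)"
    by (simp add: inner_vec_def sum_nonneg)
qed

text \<open>Convexity of \<open>J i\<close> in the player's own variable is hidden in the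
  monotonicity of the pseudo-gradient, applied to profiles that differ in slot \<open>i\<close>
  only. The slope at the mean value point is then at least the slope at the start, which is
  nonnegative.\<close>

lemma vi_solution_imp_nash_equilibrium:
  assumes "vi_solution (pseudo_gradient J) (profiles K) x"
  shows "is_nash_equilibrium J K x"
  unfolding is_nash_equilibrium_def
proof (intro conjI allI ballI)
  show xK: "x \<in> profiles K"
    using assms by (simp add: vi_solution_def)
  then have x: "x \<in> profiles \<Omega>"
    using profiles_mono[of K \<Omega>, OF K(2)] by blast
  fix i y assume y: "y \<in> K i"
  let ?v = "y - x $ i" and ?F = "pseudo_gradient J"
  let ?\<phi> = "\<lambda>t. J i (deviate x i (x $ i + t *\<^sub>R ?v))"
  have xi: "x $ i \<in> K i"
    using xK by (simp add: profiles_def)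
  have seg: "x $ i + t *\<^sub>R ?v \<in> \<Omega> i" if "0 \<le> t" "t \<le> 1" for t
    using segment_in_K[OF xi y that] K(2) by blast
  have "deviate x i y - x = axis i ?v"
    using deviate_diff[of x i y "x $ i"] by simp
  then have dir: "0 \<le> ?F x $ i \<bullet> ?v"
    using assms deviate_in_profiles[of x K y i] xK y by (auto simp: vi_solution_def inner_axis)
  have "\<exists>\<xi>>0. \<xi> < 1 \<and> ?\<phi> 1 - ?\<phi> 0 = (1 - 0) * (?v \<bullet> ?F (deviate x i (x $ i + \<xi> *\<^sub>R ?v)) $ i)"
    by (rule MVT2) (use seg x in \<open>auto intro!: J_line_derivative\<close>)
  then obtain \<xi> where \<xi>: "0 < \<xi>" "\<xi> < 1"
    "J i (deviate x i y) - J i x = ?v \<bullet> ?F (deviate x i (x $ i + \<xi> *\<^sub>R ?v)) $ i"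
    by auto
  let ?w = "deviate x i (x $ i + \<xi> *\<^sub>R ?v)"
  have w: "?w \<in> profiles \<Omega>"
    using seg \<xi> x by (intro deviate_in_profiles) auto
  \<comment> \<open>The difference lives in slot \<open>i\<close>, so the monotonicity inequality
    reduces to a comparison of the \<open>i\<close>-th components of the pseudo-gradient.\<close>
  have "?w - x = axis i (\<xi> *\<^sub>R ?v)"
    using deviate_diff[of x i "x $ i + \<xi> *\<^sub>R ?v" "x $ i"] by simp
  moreover have "0 \<le> \<kappa> * (norm (?w - x))\<^sup>2"
    using \<kappa>_pos by simp
  ultimately have "0 \<le> \<xi> * ((?F ?w $ i - ?F x $ i) \<bullet> ?v)"
    using monotone[OF w x] by (simp add: inner_axis)
  then have "?F x $ i \<bullet> ?v \<le> ?F ?w $ i \<bullet> ?v"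
    using \<xi>(1) by (simp add: zero_le_mult_iff inner_diff_left)
  then show "J i x \<le> J i (deviate x i y)"
    using dir \<xi>(3) by (simp add: inner_commute)
qed

text \<open>Uniqueness transfers from the variational inequality, which makes the definite
  description in \<open>nash_equilibrium\<close> meaningful.\<close>

lemma nash_equilibrium_is_vi_solution:
  assumes "\<exists>x. vi_solution (pseudo_gradient J) (profiles K) x"
  shows "is_nash_equilibrium J K (nash_equilibrium J K)"
    and "vi_solution (pseudo_gradient J) (profiles K) (nash_equilibrium J K)"
proof -
  have "profiles K \<subseteq> profiles \<Omega>"
    by (rule profiles_mono[OF K(2)])
  then have mono: "\<kappa> * (norm (x - y))\<^sup>2 \<le> (pseudo_gradient J x - pseudo_gradient J y) \<bullet> (x - y)"
    if "x \<in> profiles K" "y \<in> profiles K" for x y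
    using that by (intro monotone) auto
  have "is_nash_equilibrium J K x \<Longrightarrow> is_nash_equilibrium J K y \<Longrightarrow> x = y" for x y
    using vi_solution_unique[OF \<kappa>_pos mono] nash_equilibrium_imp_vi_solution by blast
  then show "is_nash_equilibrium J K (nash_equilibrium J K)"
    using assms vi_solution_imp_nash_equilibrium unfolding nash_equilibrium_def by (metis theI)
  then show "vi_solution (pseudo_gradient J) (profiles K) (nash_equilibrium J K)"
    by (rule nash_equilibrium_imp_vi_solution)
qed

end

end

section \<open>Aggregative games\<close>

locale aggregative_game =
  fixes \<Omega> :: "'p::finite \<Rightarrow> (real^'n) set"
    and f :: "'p \<Rightarrow> (real^'n) \<times> (real^'m) \<Rightarrow> real" and q :: "'p \<Rightarrow> real^'n \<Rightarrow> real^'m"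
    and \<kappa> c1 c2 c3 :: real and E :: "('p \<times> 'p) set" and A :: "real^'p^'p"
  assumes standing: "standing_assumptions \<Omega> f q \<kappa> c1 c2 c3 E A"
begin

abbreviation "J \<equiv> payoff f q"
abbreviation "F \<equiv> pseudo_gradient J"

lemma compact_\<Omega>: "compact (\<Omega> i)" and convex_\<Omega>: "convex (\<Omega> i)" and \<Omega>_nonempty: "\<Omega> i \<noteq> {}"
  using standing by (auto simp: standing_assumptions_def Let_def)

lemma c_pos: "0 < c1" "0 < c2" "0 < c3"
  using standing by (auto simp: standing_assumptions_def Let_def)

lemma q_lipschitz: "c3-lipschitz_on (\<Omega> i) (q i)"
  using standing by (auto simp: standing_assumptions_def Let_def)

sublocale monotone_game J \<Omega> \<kappa>
  using standing by unfold_locales (auto simp: standing_assumptions_def Let_def)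

section \<open>Derivatives and Lipschitz bounds for the aggregative structure\<close>

lemma q_has_derivative:
  assumes "y \<in> \<Omega> i"
  shows "(q i has_derivative (\<lambda>h. jacobian (q i) (at y) *v h)) (at y)"
proof -
  have "C1_on (q i) (\<Omega> i)"
    using standing by (auto simp: standing_assumptions_def Let_def)
  then have "q i differentiable at y"
    using assms unfolding C1_on_def differentiable_def by blast
  then show ?thesis
    by (simp add: jacobian_works)
qed

lemma aggregate_deviate_has_derivative:
  assumes "y \<in> \<Omega> i"
  shows "((\<lambda>y. aggregate q (deviate x i y)) has_derivative
    (\<lambda>h. (1 / real CARD('p)) *\<^sub>R (jacobian (q i) (at y) *v h))) (at y)"
proof -
  have "aggregate q (deviate x i y) =
      (1 / real CARD('p)) *\<^sub>R (q i y + (\<Sum>j\<in>UNIV - {i}. q j (x $ j)))" for y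
    by (simp add: aggregate_def deviate_nth sum.remove[of UNIV i])
  moreover have "((\<lambda>y. (1 / real CARD('p)) *\<^sub>R (q i y + (\<Sum>j\<in>UNIV - {i}. q j (x $ j))))
      has_derivative (\<lambda>h. (1 / real CARD('p)) *\<^sub>R (jacobian (q i) (at y) *v h + 0))) (at y)"
    by (intro has_derivative_scaleR_right has_derivative_add has_derivative_const
        q_has_derivative assms)
  ultimately show ?thesis
    by simp
qed

text \<open>Chain rule through \<open>y \<mapsto> (y, aggregate q (deviate x i y))\<close>: own
  strategy enters directly and through the aggregate. The total derivative splits into the two
  partial gradients, and the transpose carries the Jacobian to the other side of the inner
  product.\<close>

lemma pseudo_gradient_eq_U_map:
  assumes "x \<in> profiles \<Omega>"
  shows "F x = U_map f q x (\<chi> i. aggregate q x)"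
proof (subst vec_eq_iff, intro allI)
  fix i
  let ?y = "x $ i" and ?s = "aggregate q x" and ?N = "1 / real CARD('p)"
  let ?Dq = "jacobian (q i) (at ?y)"
  define g1 where "g1 = gradient (\<lambda>y. f i (y, ?s)) ?y"
  define g2 where "g2 = gradient (\<lambda>s. f i (?y, s)) ?s"
  have y: "?y \<in> \<Omega> i"
    using assms by (simp add: profiles_def)
  then have "f i differentiable (at (?y, ?s))"
    using standing by (auto simp: standing_assumptions_def Let_def)
  then obtain f' where f': "(f i has_derivative f') (at (?y, ?s))"
    unfolding differentiable_def by blast
  interpret f': bounded_linear f'
    using f' by (rule has_derivative_bounded_linear)
  have d1: "((\<lambda>y. f i (y, ?s)) has_derivative (\<lambda>h. f' (h, 0))) (at ?y)"
    by (rule has_derivative_compose[where g = "f i"]) (auto intro!: derivative_eq_intros f')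
  have d2: "((\<lambda>s. f i (?y, s)) has_derivative (\<lambda>h. f' (0, h))) (at ?s)"
    by (rule has_derivative_compose[where g = "f i"]) (auto intro!: derivative_eq_intros f')
  have f'1: "f' (h, 0) = h \<bullet> g1" for h
    using has_derivative_unique[OF d1 GDERIV_gradient[OF d1, unfolded gderiv_def]]
    by (metis g1_def)
  have f'2: "f' (0, h) = h \<bullet> g2" for h
    using has_derivative_unique[OF d2 GDERIV_gradient[OF d2, unfolded gderiv_def]]
    by (metis g2_def)
  have "((\<lambda>y. (y, aggregate q (deviate x i y))) has_derivative
      (\<lambda>h. (h, ?N *\<^sub>R (?Dq *v h)))) (at ?y)"
    by (intro has_derivative_Pair has_derivative_ident aggregate_deviate_has_derivative y)
  then have "((\<lambda>y. f i (y, aggregate q (deviate x i y))) has_derivative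
      (\<lambda>h. f' (h, ?N *\<^sub>R (?Dq *v h)))) (at ?y)"
    by (rule has_derivative_compose) (simp add: f')
  moreover have "f' (h, ?N *\<^sub>R (?Dq *v h)) = h \<bullet> (g1 + ?N *\<^sub>R (transpose ?Dq *v g2))" for h
  proof -
    have "f' (h, ?N *\<^sub>R (?Dq *v h)) = f' (h, 0) + f' (0, ?N *\<^sub>R (?Dq *v h))"
      using f'.add[of "(h, 0)" "(0, ?N *\<^sub>R (?Dq *v h))"] by simp
    also have "\<dots> = h \<bullet> g1 + ?N * ((?Dq *v h) \<bullet> g2)"
      by (simp add: f'1 f'2)
    also have "(?Dq *v h) \<bullet> g2 = h \<bullet> (transpose ?Dq *v g2)"
      by (metis dot_lmul_matrix inner_commute transpose_matrix_vector)
    finally show ?thesis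
      by (simp add: inner_add_right)
  qed
  moreover have "(\<lambda>y. J i (deviate x i y)) = (\<lambda>y. f i (y, aggregate q (deviate x i y)))"
    by (simp add: payoff_def deviate_nth)
  ultimately have "GDERIV (\<lambda>y. J i (deviate x i y)) ?y :> g1 + ?N *\<^sub>R (transpose ?Dq *v g2)"
    by (simp add: gderiv_def)
  then show "F x $ i = U_map f q x (\<chi> i. aggregate q x) $ i"
    using gradient_eq by (simp add: pseudo_gradient_def U_map_def g1_def g2_def)
qed

text \<open>Changing first the strategies with frozen aggregates costs \<open>c1\<close>, then
  changing the aggregates costs \<open>c2 * c3\<close>.\<close>

lemma pseudo_gradient_lipschitz:
  assumes x: "x \<in> profiles \<Omega>" and y: "y \<in> profiles \<Omega>"
  shows "norm (F x - F y) \<le> (c1 + c2 * c3) * norm (x - y)"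
proof -
  let ?Q = "\<lambda>x. \<chi> i::'p. aggregate q x"
  let ?w = "\<chi> i. q i (x $ i) - q i (y $ i)"
  have U1: "c1-lipschitz_on (profiles \<Omega>) (\<lambda>x. U_map f q x (?Q x'))" for x'
    using standing by (auto simp: standing_assumptions_def Let_def)
  have U2: "c2-lipschitz_on UNIV (U_map f q y)"
    using standing y by (auto simp: standing_assumptions_def Let_def)
  \<comment> \<open>The difference of the stacked aggregates is the mean part of \<open>?w\<close>,
    hence no longer than \<open>?w\<close>.\<close>
  have "norm (?Q x - ?Q y) = norm (\<chi> i::'p. (1 / real CARD('p)) *\<^sub>R (\<Sum>j\<in>UNIV. ?w $ j))"
    by (rule arg_cong[where f = norm])
      (simp add: vec_eq_iff aggregate_def sum_subtractf scaleR_diff_right)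
  also have "\<dots> \<le> norm ?w"
    by (rule norm_mean_vec_le)
  also have "\<dots> \<le> c3 * norm (x - y)"
    using c_pos lipschitz_onD[OF q_lipschitz] x y
    by (intro norm_vec_le_mult) (auto simp: profiles_def dist_norm)
  finally have Q: "norm (?Q x - ?Q y) \<le> c3 * norm (x - y)" .
  have "norm (F x - F y) = dist (U_map f q x (?Q x)) (U_map f q y (?Q y))"
    using x y by (simp add: pseudo_gradient_eq_U_map dist_norm)
  also have "\<dots> \<le> dist (U_map f q x (?Q x)) (U_map f q y (?Q x)) +
      dist (U_map f q y (?Q x)) (U_map f q y (?Q y))"
    by (rule dist_triangle)
  also have "\<dots> \<le> c1 * norm (x - y) + c2 * norm (?Q x - ?Q y)"
    using lipschitz_onD[OF U1 x y] lipschitz_onD[OF U2, of "?Q x" "?Q y"]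
    by (intro add_mono) (auto simp: dist_norm)
  also have "\<dots> \<le> c1 * norm (x - y) + c2 * (c3 * norm (x - y))"
    using Q c_pos by (intro add_left_mono mult_left_mono) auto
  finally show ?thesis
    by (simp add: algebra_simps)
qed

text \<open>The derivative sends \<open>v\<close> to the deviation from the mean of the stacked
  vectors \<open>Dq_i v_i\<close>, so subtracting the aggregate costs nothing and the slotwise bound
  \<open>c3\<close> survives. Feasibility of \<open>x + v\<close> makes each \<open>v $ i\<close> a
  direction into \<open>\<Omega> i\<close>.\<close>

lemma consensus_derivative_norm_le:
  assumes x: "x \<in> profiles \<Omega>" "x + v \<in> profiles \<Omega>"
  shows "norm (frechet_derivative (\<lambda>y. \<chi> i. q i (y $ i) - aggregate q y) (at x) v) \<le> c3 * norm v"
proof -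
  let ?D = "\<lambda>i h. jacobian (q i) (at (x $ i)) *v (h $ i)"
  let ?w = "\<chi> i. ?D i v"
  have q': "((\<lambda>y. q i (y $ i)) has_derivative ?D i) (at x)" for i
    using x by (intro has_derivative_compose[OF _ q_has_derivative])
      (auto simp: profiles_def intro: has_derivative_bounded_linear bounded_linear_imp_has_derivative)
  have "((\<lambda>y. \<chi> i. q i (y $ i) - aggregate q y) has_derivative
      (\<lambda>h. \<chi> i. ?D i h - (1 / real CARD('p)) *\<^sub>R (\<Sum>j\<in>UNIV. ?D j h))) (at x)"
    unfolding aggregate_def
    by (intro has_derivative_vec_lambda has_derivative_diff has_derivative_scaleR_right
        has_derivative_sum q')
  then have "frechet_derivative (\<lambda>y. \<chi> i. q i (y $ i) - aggregate q y) (at x) v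
      = (\<chi> i. ?w $ i - (1 / real CARD('p)) *\<^sub>R (\<Sum>j\<in>UNIV. ?w $ j))"
    by (simp add: frechet_derivative_at[symmetric])
  also have "norm \<dots> \<le> norm ?w"
    by (rule norm_mean_vec_le)
  also have "\<dots> \<le> c3 * norm v"
    using c_pos x
    by (intro norm_vec_le_mult)
      (auto simp: profiles_def intro!: lipschitz_on_derivative_norm_le q_lipschitz convex_\<Omega>
        q_has_derivative)
  finally show ?thesis .
qed

section \<open>Consequences of the step-size conditions\<close>

context
  fixes \<beta>1 \<beta>2 :: real
  assumes steps: "step_sizes \<kappa> c1 c2 c3 (laplacian A) \<beta>1 \<beta>2"
begin

lemma step_size_\<beta>1: "0 < \<beta>1" "0 < c1 + c2 * c3" "\<beta>1 < 2 * \<kappa> / (c1 + c2 * c3)\<^sup>2"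
  using steps c_pos by (auto simp: step_sizes_def Let_def add_pos_pos)

text \<open>The monotonicity and Lipschitz constants are inherited by subsets of
  \<open>\<Omega>\<close>, so the same \<open>\<beta>1\<close> gives a contraction for every such
  \<open>K\<close>.\<close>

lemma nash_equilibrium_subgame:
  assumes K: "\<And>i. closed (K i)" "\<And>i. convex (K i)" "\<And>i. K i \<subseteq> \<Omega> i" "\<And>i. K i \<noteq> {}"
  shows "is_nash_equilibrium J K (nash_equilibrium J K)"
    and "vi_solution F (profiles K) (nash_equilibrium J K)"
proof -
  have sub: "profiles K \<subseteq> profiles \<Omega>"
    by (rule profiles_mono[OF K(3)])
  have ex: "\<exists>x. vi_solution F (profiles K) x"
    by (rule vi_solution_exists[OF closed_profiles[OF K(1)] convex_profiles[OF K(2)]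
          profiles_nonempty[OF K(4)] step_size_\<beta>1])
      (use sub in \<open>auto intro: monotone pseudo_gradient_lipschitz\<close>)
  show "is_nash_equilibrium J K (nash_equilibrium J K)"
    and "vi_solution F (profiles K) (nash_equilibrium J K)"
    using nash_equilibrium_is_vi_solution[OF K(2,3) ex] by auto
qed

text \<open>At zero consensus error the Laplacian term vanishes and \<open>U_map\<close> is
  evaluated at the true aggregate, so the first block is the displacement of the projected step. The
  second block is at most \<open>c3\<close> times as long.\<close>

lemma G_field_norm_le:
  assumes x: "x \<in> profiles \<Omega>"
  shows "norm (G_field \<Omega> f q (laplacian A) \<beta>1 \<beta>2 (x, 0))
    \<le> 2 * (1 + c3) * norm (x - nash_equilibrium J \<Omega>)"
proof -
  let ?P = "P_field \<Omega> f q \<beta>1 (x, 0)"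
  have cl: "closed (profiles \<Omega>)" and cv: "convex (profiles \<Omega>)"
    using compact_\<Omega> convex_\<Omega> by (auto intro: closed_profiles convex_profiles compact_imp_closed)
  have P: "?P = closest_point (profiles \<Omega>) (x - \<beta>1 *\<^sub>R F x) - x"
    by (simp add: P_field_def pseudo_gradient_eq_U_map[OF x])
  \<comment> \<open>The displacement ends in the feasible set, as the directional derivative bound
    requires.\<close>
  have "x + ?P \<in> profiles \<Omega>"
    unfolding P using closest_point_in_set[OF cl] x by auto
  then have D: "norm (frechet_derivative (\<lambda>y. \<chi> i. q i (y $ i) - aggregate q y) (at x) ?P)
      \<le> c3 * norm ?P"
    by (rule consensus_derivative_norm_le[OF x])
  have "vi_solution F (profiles \<Omega>) (nash_equilibrium J \<Omega>)"
    using compact_\<Omega> convex_\<Omega> \<Omega>_nonempty by (intro nash_equilibrium_subgame) (auto intro: compact_imp_closed)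
  then have normP: "norm ?P \<le> 2 * norm (x - nash_equilibrium J \<Omega>)"
    unfolding P using x
    by (intro projected_step_norm_le[OF cl cv step_size_\<beta>1] monotone pseudo_gradient_lipschitz)
  have "(\<chi> i. \<Sum>j\<in>UNIV. laplacian A $ i $ j *\<^sub>R (0 :: (real^'m)^'p) $ j) = 0"
    by (simp add: vec_eq_iff)
  then have "G_field \<Omega> f q (laplacian A) \<beta>1 \<beta>2 (x, 0) =
      (?P, frechet_derivative (\<lambda>y. \<chi> i. q i (y $ i) - aggregate q y) (at x) ?P)"
    by (simp add: G_field_def)
  also have "norm \<dots> \<le> norm ?P + c3 * norm ?P"
    by (rule order_trans[OF norm_Pair_le add_left_mono[OF D]])
  also have "\<dots> \<le> (1 + c3) * (2 * norm (x - nash_equilibrium J \<Omega>))"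
    using mult_left_mono[OF normP, of "1 + c3"] c_pos by (simp add: algebra_simps)
  finally show ?thesis
    by (simp add: algebra_simps)
qed

text \<open>At a state off the equilibrium with zero consensus error, all terms scale with
  \<open>d\<^sup>2\<close> and \<open>d > 0\<close> can be divided out. The two-sided bound on
  \<open>V\<close> gives the first claim; Cauchy-Schwarz with the bounds on the gradient and the
  field gives the second.\<close>

lemma lyapunov_constants:
  assumes lyap: "lyapunov_inequalities V (G_field \<Omega> f q (laplacian A) \<beta>1 \<beta>2) (state_set \<Omega>)
      (nash_equilibrium J \<Omega>, 0) a1 a2 a3 a4"
    and a4: "0 < a4" and x: "x \<in> profiles \<Omega>" "x \<noteq> nash_equilibrium J \<Omega>"
  shows "a1 \<le> a2" and "a3 \<le> 2 * (1 + c3) * a4"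
proof -
  let ?G = "G_field \<Omega> f q (laplacian A) \<beta>1 \<beta>2 (x, 0)"
  define d where "d = norm (x - nash_equilibrium J \<Omega>)"
  have d: "0 < d"
    using x(2) by (simp add: d_def)
  have "(x, 0) \<in> state_set \<Omega>"
    using x(1) by (simp add: state_set_def)
  moreover have "norm ((x, 0) - (nash_equilibrium J \<Omega>, 0 :: (real^'m)^'p)) = d"
    by (simp add: d_def)
  ultimately have V: "a1 * d\<^sup>2 \<le> V (x, 0)" "V (x, 0) \<le> a2 * d\<^sup>2"
    "gradient V (x, 0) \<bullet> ?G \<le> - a3 * d\<^sup>2" "norm (gradient V (x, 0)) \<le> a4 * d"
    using lyap unfolding lyapunov_inequalities_def by metis+
  then have "a1 * d\<^sup>2 \<le> a2 * d\<^sup>2"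
    by linarith
  then show "a1 \<le> a2"
    using d by simp
  have "a3 * d\<^sup>2 \<le> norm (gradient V (x, 0)) * norm ?G"
    using V(3) Cauchy_Schwarz_ineq2[of "gradient V (x, 0)" ?G] by linarith
  also have "\<dots> \<le> (a4 * d) * (2 * (1 + c3) * d)"
    using V(4) G_field_norm_le[OF x(1)] a4 d by (intro mult_mono) (auto simp: d_def)
  finally have "a3 * d\<^sup>2 \<le> (2 * (1 + c3) * a4) * d\<^sup>2"
    by (simp add: power2_eq_square algebra_simps)
  then show "a3 \<le> 2 * (1 + c3) * a4"
    using d by simp
qed

text \<open>The nearest point \<open>z\<close> of \<open>K i\<close> to \<open>y\<close> is an
  admissible deviation in the restricted game and hence no improvement; replacing \<open>z\<close>
  by \<open>y\<close> changes one slot and costs at most \<open>\<rho> * dist y z\<close>.\<close>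

lemma nash_equilibrium_approximation:
  assumes K: "\<And>i. compact (K i)" "\<And>i. convex (K i)" "\<And>i. K i \<subseteq> \<Omega> i" "\<And>i. K i \<noteq> {}"
    and lip: "\<rho>-lipschitz_on (profiles \<Omega>) (J i)" and y: "y \<in> \<Omega> i"
  shows "J i (nash_equilibrium J K) - J i (deviate (nash_equilibrium J K) i y) \<le> \<rho> * infdist y (K i)"
proof -
  let ?x = "nash_equilibrium J K"
  have nash: "is_nash_equilibrium J K ?x"
    using K by (intro nash_equilibrium_subgame) (auto intro: compact_imp_closed)
  then have x: "?x \<in> profiles \<Omega>"
    using profiles_mono[of K \<Omega>, OF K(3)] by (auto simp: is_nash_equilibrium_def)
  obtain z where z: "z \<in> K i" "infdist y (K i) = dist y z"
    using infdist_attains_inf[OF compact_imp_closed[OF K(1)] K(4)] by metis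
  have "J i ?x \<le> J i (deviate ?x i z)"
    using nash z(1) by (simp add: is_nash_equilibrium_def)
  moreover have "dist (J i (deviate ?x i z)) (J i (deviate ?x i y)) \<le> \<rho> * dist (deviate ?x i z) (deviate ?x i y)"
    using x y z(1) K(3) by (intro lipschitz_onD[OF lip] deviate_in_profiles) auto
  moreover have "dist (deviate ?x i z) (deviate ?x i y) = dist y z"
    by (simp add: dist_norm deviate_diff norm_eq_sqrt_inner inner_axis_axis inner_diff_left
        inner_diff_right)
  ultimately show ?thesis
    by (simp add: z(2) dist_real_def)
qed

end

end

section \<open>Inscribed polyhedra\<close>

lemma inscribed_polyhedron_subset:
  assumes "inscribed_polyhedron K D" "compact K" "convex K"
  shows "D \<subseteq> K"
proof -
  have "frontier K \<subseteq> K"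
    using assms(2) by (intro frontier_subset_closed compact_imp_closed)
  then have vertices: "{v. v extreme_point_of D} \<subseteq> K"
    using assms(1) unfolding inscribed_polyhedron_def by blast
  have "D = convex hull {v. v extreme_point_of D}"
    using assms by (intro Krein_Milman_Minkowski)
      (auto simp: inscribed_polyhedron_def polytope_imp_compact polytope_imp_convex)
  also have "\<dots> \<subseteq> K"
    by (intro hull_minimal vertices assms(3))
  finally show ?thesis .
qed

text \<open>The diameter bounds every point-to-set distance involved, so the suprema are genuine.
  The bound by \<open>diameter K\<close>, uniform in \<open>D\<close>, is what lets \<nu> be chosen
  from the feasible set alone.\<close>

lemma hausdorff_dist_subset:
  fixes K :: "'a::heine_borel set"
  assumes "compact K" "D \<subseteq> K" "D \<noteq> {}"
  shows "y \<in> K \<Longrightarrow> infdist y D \<le> hausdorff_dist K D"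
    and "hausdorff_dist K D \<le> diameter K"
proof -
  have bnd: "infdist a B \<le> diameter K" if B: "a \<in> K" "B \<subseteq> K" "B \<noteq> {}" for a B
  proof -
    obtain b where "b \<in> B"
      using B by blast
    then have "infdist a B \<le> dist a b"
      by (rule infdist_le)
    also have "\<dots> \<le> diameter K"
      using B \<open>b \<in> B\<close> assms by (intro diameter_bounded_bound compact_imp_bounded) auto
    finally show ?thesis .
  qed
  then have "bdd_above ((\<lambda>a. infdist a D) ` K)"
    using assms by (intro bdd_aboveI2) auto
  then show "y \<in> K \<Longrightarrow> infdist y D \<le> hausdorff_dist K D"
    unfolding hausdorff_dist_def by (auto intro!: max.coboundedI1 cSUP_upper)
  show "hausdorff_dist K D \<le> diameter K"
    unfolding hausdorff_dist_def using assms bnd by (auto intro!: cSUP_least)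
qed

text \<open>The hypotheses place the argument of \<open>arccos\<close> in [-1, 1], where its value
  is nonnegative; the Euclidean norm then dominates each component.\<close>

lemma delta_ge:
  assumes "0 \<le> c3" and "\<And>i. 0 < \<nu> i" "\<And>i. 0 \<le> h i" "\<And>i. \<nu> i * h i \<le> 2"
  shows "(1 + c3) * h i \<le> delta c3 \<nu> h"
proof -
  let ?t = "\<lambda>i. 2 / \<nu> i * arccos (1 - \<nu> i * h i) + h i"
  have "h i \<le> ?t i"
    using assms(2)[of i] assms(3)[of i] assms(4)[of i] by (simp add: arccos_lbound)
  also have "\<dots> \<le> L2_set ?t UNIV"
    by (rule member_le_L2_set) auto
  finally show ?thesis
    using assms(1) by (simp add: delta_def L2_set_def)
qed

section \<open>The error bound for inscribed polyhedra\<close>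

theorem theorem2:
  shows "\<exists>\<nu> :: (real^'n) set \<Rightarrow> real.
    (\<forall>K. compact K \<and> convex K \<longrightarrow> 0 < \<nu> K) \<and>
    (\<forall>(\<Omega> :: 'p::finite \<Rightarrow> (real^'n) set)
       (f :: 'p \<Rightarrow> (real^'n) \<times> (real^'m) \<Rightarrow> real) (q :: 'p \<Rightarrow> real^'n \<Rightarrow> real^'m)
       \<kappa> c1 c2 c3 E A \<beta>1 \<beta>2 \<rho> V a1 a2 a3 a4 \<mu>.
      standing_assumptions \<Omega> f q \<kappa> c1 c2 c3 E A \<and>
      step_sizes \<kappa> c1 c2 c3 (laplacian A) \<beta>1 \<beta>2 \<and>
      (\<forall>i. (\<rho> i)-lipschitz_on (profiles \<Omega>) (payoff f q i)) \<and>
      0 < a1 \<and> 0 < a2 \<and> 0 < a3 \<and> 0 < a4 \<and>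
      lyapunov_inequalities V (G_field \<Omega> f q (laplacian A) \<beta>1 \<beta>2) (state_set \<Omega>)
        (nash_equilibrium (payoff f q) \<Omega>, 0) a1 a2 a3 a4 \<and>
      0 < \<mu> \<and> \<mu> < 1
      \<longrightarrow>
      (\<forall>D. (\<forall>i. inscribed_polyhedron (\<Omega> i) (D i)) \<longrightarrow>
        (let h = (\<lambda>i. hausdorff_dist (\<Omega> i) (D i));
             xD = nash_equilibrium (payoff f q) D
         in (\<forall>i. -1 \<le> 1 - \<nu> (\<Omega> i) * h i) \<and>
            xD \<in> profiles \<Omega> \<and>
            (\<forall>i. \<forall>y\<in>\<Omega> i.
               payoff f q i xD - payoff f q i (deviate xD i y)
                 \<le> 2 * a4 / a3 * sqrt (a2 / a1) * (\<rho> i / \<mu>) * delta c3 (\<lambda>i. \<nu> (\<Omega> i)) h))))"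
\<comment> \<open>With this witness \<open>\<nu> K * h \<le> 1\<close> for every Hausdorff distance
  \<open>h \<le> diameter K\<close>; the added 1 keeps the value positive for sets of diameter
  0.\<close>
proof (rule exI[of _ "\<lambda>K. 1 / (1 + diameter K)"], intro conjI allI impI, goal_cases)
  case (1 K)
  then show ?case
    using diameter_ge_0[of K] by (simp add: compact_imp_bounded)
next
  case (2 \<Omega> f q \<kappa> c1 c2 c3 E A \<beta>1 \<beta>2 \<rho> V a1 a2 a3 a4 \<mu> D)
  then interpret aggregative_game \<Omega> f q \<kappa> c1 c2 c3 E A
    by unfold_locales blast
  note prems = 2
  let ?\<nu> = "\<lambda>i. 1 / (1 + diameter (\<Omega> i))"
  define h where "h = (\<lambda>i. hausdorff_dist (\<Omega> i) (D i))"
  define xD where "xD = nash_equilibrium (payoff f q) D"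
  have steps: "step_sizes \<kappa> c1 c2 c3 (laplacian A) \<beta>1 \<beta>2"
    using prems by blast
  have lyap: "lyapunov_inequalities V (G_field \<Omega> f q (laplacian A) \<beta>1 \<beta>2) (state_set \<Omega>)
      (nash_equilibrium J \<Omega>, 0) a1 a2 a3 a4"
    using prems by blast
  have a: "0 < a1" "0 < a2" "0 < a3" "0 < a4" "0 < \<mu>" "\<mu> < 1"
    using prems by blast+
  have D: "compact (D i)" "convex (D i)" "D i \<subseteq> \<Omega> i" "D i \<noteq> {}" for i
    using prems inscribed_polyhedron_subset[OF _ compact_\<Omega> convex_\<Omega>]
    by (auto simp: inscribed_polyhedron_def polytope_imp_compact polytope_imp_convex)
  have h: "infdist y (D i) \<le> h i" if "y \<in> \<Omega> i" for y i
    unfolding h_def using hausdorff_dist_subset(1)[OF compact_\<Omega> D(3,4)] that .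
  have h_nonneg: "0 \<le> h i" for i
    using h \<Omega>_nonempty infdist_nonneg by (meson ex_in_conv order_trans)
  have \<nu>: "0 < ?\<nu> i" "?\<nu> i * h i \<le> 2" for i
  proof -
    have "h i \<le> diameter (\<Omega> i)"
      unfolding h_def by (rule hausdorff_dist_subset(2)[OF compact_\<Omega> D(3,4)])
    moreover have "0 \<le> diameter (\<Omega> i)"
      by (intro diameter_ge_0 compact_imp_bounded compact_\<Omega>)
    ultimately show "0 < ?\<nu> i" "?\<nu> i * h i \<le> 2"
      by (simp_all add: pos_divide_le_eq)
  qed
  have xD: "xD \<in> profiles D"
    unfolding xD_def using nash_equilibrium_subgame(1)[OF steps] D
    by (simp add: is_nash_equilibrium_def compact_imp_closed)
  then have x\<Omega>: "xD \<in> profiles \<Omega>"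
    using profiles_mono[of D \<Omega>, OF D(3)] by blast
  have "payoff f q i xD - payoff f q i (deviate xD i y)
      \<le> 2 * a4 / a3 * sqrt (a2 / a1) * (\<rho> i / \<mu>) * delta c3 ?\<nu> h" if y: "y \<in> \<Omega> i" for i y
  proof -
    have lip: "(\<rho> i)-lipschitz_on (profiles \<Omega>) (J i)"
      using prems by blast
    then have \<rho>: "0 \<le> \<rho> i"
      by (rule lipschitz_on_nonneg)
    have \<delta>: "(1 + c3) * h i \<le> delta c3 ?\<nu> h"
      using c_pos \<nu> h_nonneg by (intro delta_ge) auto
    have \<delta>0: "0 \<le> delta c3 ?\<nu> h"
      using mult_nonneg_nonneg[of "1 + c3" "h i"] \<delta> c_pos h_nonneg[of i] by linarith
    show ?thesis
    \<comment> \<open>If the equilibrium is the only profile, no state off the equilibrium with zero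
      consensus error is available to compare the constants, but every deviation is trivial and the
      left-hand side is 0.\<close>
    proof (cases "profiles \<Omega> \<subseteq> {nash_equilibrium J \<Omega>}")
      case True
      then have "deviate xD i y = xD"
        using x\<Omega> deviate_in_profiles[of xD \<Omega>, OF x\<Omega> y] by auto
      then show ?thesis
        using a \<rho> \<delta>0 by simp
    next
      case False
      then obtain x where x: "x \<in> profiles \<Omega>" "x \<noteq> nash_equilibrium J \<Omega>"
        by blast
      have c: "a1 \<le> a2" "a3 \<le> 2 * (1 + c3) * a4"
        using lyapunov_constants[OF steps lyap a(4) x] by auto
      have "payoff f q i xD - payoff f q i (deviate xD i y) \<le> \<rho> i * infdist y (D i)"
        unfolding xD_def by (rule nash_equilibrium_approximation[OF steps D lip y])
      also have "\<dots> \<le> \<rho> i * h i"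
        using h[OF y] \<rho> by (rule mult_left_mono)
      \<comment> \<open>Each of the three inserted factors is at least 1. The \<open>1 + c3\<close>
        in the first is then regrouped with \<open>h i\<close> and absorbed into
        \<open>delta\<close>.\<close>
      also have "\<dots> \<le> (2 * a4 / a3 * (1 + c3)) * sqrt (a2 / a1) * (1 / \<mu>) * (\<rho> i * h i)"
      proof -
        have "1 * 1 * 1 \<le> (2 * a4 / a3 * (1 + c3)) * sqrt (a2 / a1) * (1 / \<mu>)"
          using a c c_pos by (intro mult_mono) (auto simp: field_simps)
        then have "1 * (\<rho> i * h i) \<le> (2 * a4 / a3 * (1 + c3)) * sqrt (a2 / a1) * (1 / \<mu>) * (\<rho> i * h i)"
          using \<rho> h_nonneg by (intro mult_right_mono) auto
        then show ?thesis
          by simp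
      qed
      also have "\<dots> = 2 * a4 / a3 * sqrt (a2 / a1) * (\<rho> i / \<mu>) * ((1 + c3) * h i)"
        by simp
      also have "\<dots> \<le> 2 * a4 / a3 * sqrt (a2 / a1) * (\<rho> i / \<mu>) * delta c3 ?\<nu> h"
        using \<delta> a \<rho> by (intro mult_left_mono) auto
      finally show ?thesis .
    qed
  qed
  then show ?case
    using x\<Omega> \<nu>(2) unfolding Let_def h_def[symmetric] xD_def[symmetric] by simp
qed

end
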